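(* Let $\Omega,\Theta$ be measurable spaces, let $P=(P_\theta\mid\theta\in\Theta)$ be a statistical model on $\Omega$, let $Q$ be a probability measure on $\Theta$ (the prior measure), and let $T$ be the joint probability measure on $\Omega\times\Theta$, determined by $T(A\times B)=\int_B P_\theta(A)\,Q(\mathrm{d}\theta)$ for all measurable $A\subseteq\Omega$ and $B\subseteq\Theta$. Then $$\mathcal{E}_T=\bar{\mathcal{E}}_P\,\mathcal{E}_Q .$$
   Context: A statistical model $P=(P_\theta\mid\theta\in\Theta)$ on $\Omega$ is a Markov kernel with source $\Theta$ and target $\Omega$: each $P_\theta$ is a probability measure on $\Omega$, and for each measurable $A\subseteq\Omega$ the function $\theta\mapsto P_\theta(A)$ is measurable. For a probability measure $R$ on a measurable space $X$, $\mathcal{E}_R$ is the class of all e-functions with respect to $R$, i.e., measurable functions $f:X\to[0,\infty]$ with $\int f\,\mathrm{d}R\le1$. Thus $\mathcal{E}_Q$ consists of functions on $\Theta$ and $\mathcal{E}_T$ of functions on $\Omega\times\Theta$. $\bar{\mathcal{E}}_P$ is the class of all conditional e-functions with respect to $P$, i.e., measurable functions $g:\Omega\times\Theta\to[0,\infty]$ such that $\int_\Omega g(\omega;\theta)\,P_\theta(\mathrm{d}\omega)\le1$ for all $\theta\in\Theta$. The product $\bar{\mathcal{E}}_P\mathcal{E}_Q$ is the class of all measurable functions $f:\Omega\times\Theta\to[0,\infty]$ such that, for some $g\in\bar{\mathcal{E}}_P$ and $h\in\mathcal{E}_Q$, $f(\omega,\theta)=g(\omega;\theta)h(\theta)$ holds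 $T$-almost surely. The usual convention $0\cdot\infty=0$ is used. *)

theory Defs
  imports "HOL-Probability.Probability"
begin

definition statistical_model :: "'w measure \<Rightarrow> 't measure \<Rightarrow> ('t \<Rightarrow> 'w measure) \<Rightarrow> bool" where
  "statistical_model \<Omega> \<Theta> P \<longleftrightarrow>
     (\<forall>\<theta>\<in>space \<Theta>. prob_space (P \<theta>) \<and> sets (P \<theta>) = sets \<Omega>) \<and>
     (\<forall>A\<in>sets \<Omega>. (\<lambda>\<theta>. emeasure (P \<theta>) A) \<in> borel_measurable \<Theta>)"

lemma statistical_model_iff_prob_kernel:
  "statistical_model \<Omega> \<Theta> P \<longleftrightarrow> P \<in> \<Theta> \<rightarrow>\<^sub>M prob_algebra \<Omega>"
proof
  assume "statistical_model \<Omega> \<Theta> P"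
  then show "P \<in> \<Theta> \<rightarrow>\<^sub>M prob_algebra \<Omega>"
    by (intro measurable_prob_algebraI measurable_subprob_algebra)
      (auto simp: statistical_model_def prob_space_imp_subprob_space)
next
  assume P: "P \<in> \<Theta> \<rightarrow>\<^sub>M prob_algebra \<Omega>"
  have "P \<in> \<Theta> \<rightarrow>\<^sub>M subprob_algebra \<Omega>"
    using P by (rule measurable_prob_algebraD)
  then have "(\<lambda>\<theta>. emeasure (P \<theta>) A) \<in> borel_measurable \<Theta>" if "A \<in> sets \<Omega>" for A
    using that by (rule measurable_compose[OF _ measurable_emeasure_subprob_algebra])
  then show "statistical_model \<Omega> \<Theta> P"
    using measurable_space[OF P] by (auto simp: statistical_model_def space_prob_algebra)
qed

definition joint_measure ::
  "'w measure \<Rightarrow> 't measure \<Rightarrow> ('t \<Rightarrow> 'w measure) \<Rightarrow> 't measure \<Rightarrow> ('w \<times> 't) measure \<Rightarrow> bool" where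
  "joint_measure \<Omega> \<Theta> P Q T \<longleftrightarrow>
     prob_space T \<and> sets T = sets (\<Omega> \<Otimes>\<^sub>M \<Theta>) \<and>
     (\<forall>A\<in>sets \<Omega>. \<forall>B\<in>sets \<Theta>. emeasure T (A \<times> B) = (\<integral>\<^sup>+\<theta>\<in>B. emeasure (P \<theta>) A \<partial>Q))"

text \<open>The predicate determines the joint measure: it exists and is unique.\<close>

lemma ex1_joint_measure:
  assumes P: "statistical_model \<Omega> \<Theta> P"
    and Q: "prob_space Q" "sets Q = sets \<Theta>"
  shows "\<exists>!T. joint_measure \<Omega> \<Theta> P Q T"
proof
  have K[measurable]: "P \<in> Q \<rightarrow>\<^sub>M prob_algebra \<Omega>"
    using P measurable_cong_sets[OF Q(2) refl]
    unfolding statistical_model_iff_prob_kernel by blast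
  have K'[measurable]: "P \<in> Q \<rightarrow>\<^sub>M subprob_algebra \<Omega>"
    by (rule measurable_prob_algebraD[OF K])
  have setsT: "sets (\<Omega> \<Otimes>\<^sub>M Q) = sets (\<Omega> \<Otimes>\<^sub>M \<Theta>)"
    using Q(2) by (intro sets_pair_measure_cong) auto
  have setsP: "sets (P \<theta>) = sets \<Omega>" "space (P \<theta>) = space \<Omega>" if "\<theta> \<in> space Q" for \<theta>
    using subprob_measurableD[OF K' that] by auto
  define J where "J = (\<lambda>\<theta>. distr (P \<theta>) (\<Omega> \<Otimes>\<^sub>M Q) (\<lambda>\<omega>. (\<omega>, \<theta>)))"
  define T where "T = Q \<bind> J"
  have ne: "space Q \<noteq> {}"
    using Q(1) by (rule prob_space.not_empty)
  have J[measurable]: "J \<in> Q \<rightarrow>\<^sub>M subprob_algebra (\<Omega> \<Otimes>\<^sub>M Q)"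
    unfolding J_def by (rule measurable_distr2[OF _ K']) simp
  have pair: "(\<lambda>\<omega>. (\<omega>, \<theta>)) \<in> P \<theta> \<rightarrow>\<^sub>M \<Omega> \<Otimes>\<^sub>M Q" if "\<theta> \<in> space Q" for \<theta>
    using measurable_Pair2'[OF that, of \<Omega>] measurable_cong_sets[OF setsP(1)[OF that] refl] by blast
  have probP: "prob_space (P \<theta>)" if "\<theta> \<in> space Q" for \<theta>
    using measurable_space[OF K that] by (simp add: space_prob_algebra)
  have probT: "prob_space T"
    unfolding T_def
    by (rule prob_space.prob_space_bind[OF Q(1) _ J])
      (auto simp: J_def intro!: AE_I2 prob_space.prob_space_distr probP pair)
  have rect: "emeasure T (A \<times> B) = (\<integral>\<^sup>+\<theta>\<in>B. emeasure (P \<theta>) A \<partial>Q)"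
    if A: "A \<in> sets \<Omega>" and B: "B \<in> sets \<Theta>" for A B
  proof -
    have AB: "A \<times> B \<in> sets (\<Omega> \<Otimes>\<^sub>M Q)"
      using A B Q(2) by auto
    have "emeasure T (A \<times> B) = (\<integral>\<^sup>+\<theta>. emeasure (J \<theta>) (A \<times> B) \<partial>Q)"
      unfolding T_def by (rule emeasure_bind[OF ne J AB])
    also have "\<dots> = (\<integral>\<^sup>+\<theta>\<in>B. emeasure (P \<theta>) A \<partial>Q)"
    proof (rule nn_integral_cong)
      fix \<theta> assume \<theta>: "\<theta> \<in> space Q"
      have "(\<lambda>\<omega>. (\<omega>, \<theta>)) -` (A \<times> B) \<inter> space (P \<theta>) = (if \<theta> \<in> B then A else {})"
        using sets.sets_into_space[OF A] setsP(2)[OF \<theta>] by auto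
      then show "emeasure (J \<theta>) (A \<times> B) = emeasure (P \<theta>) A * indicator B \<theta>"
        unfolding J_def by (simp add: emeasure_distr[OF pair[OF \<theta>] AB])
    qed
    finally show ?thesis .
  qed
  have "sets T = sets (\<Omega> \<Otimes>\<^sub>M Q)"
    unfolding T_def by (rule sets_bind[OF _ ne]) (simp add: J_def)
  with probT rect setsT show T: "joint_measure \<Omega> \<Theta> P Q T"
    by (simp add: joint_measure_def)
  fix T' assume T': "joint_measure \<Omega> \<Theta> P Q T'"
  show "T' = T"
  proof (rule measure_eqI_generator_eq[OF Int_stable_pair_measure_generator pair_measure_closed,
        where A = "\<lambda>_::nat. space \<Omega> \<times> space \<Theta>"])
    fix X assume "X \<in> {a \<times> b |a b. a \<in> sets \<Omega> \<and> b \<in> sets \<Theta>}"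
    then show "emeasure T' X = emeasure T X"
      using T T' by (auto simp: joint_measure_def)
  next
    have "finite_measure T'"
      using T' by (auto simp: joint_measure_def prob_space_def)
    then show "emeasure T' (space \<Omega> \<times> space \<Theta>) \<noteq> \<infinity>" for i :: nat
      by (simp add: finite_measure.emeasure_finite)
  qed (use T T' in \<open>auto simp: joint_measure_def sets_pair_measure\<close>)
qed

definition e_functions :: "'x measure \<Rightarrow> ('x \<Rightarrow> ennreal) set" where
  "e_functions R = {f \<in> borel_measurable R. (\<integral>\<^sup>+x. f x \<partial>R) \<le> 1}"

definition conditional_e_functions ::
  "'w measure \<Rightarrow> 't measure \<Rightarrow> ('t \<Rightarrow> 'w measure) \<Rightarrow> ('w \<times> 't \<Rightarrow> ennreal) set" where
  "conditional_e_functions \<Omega> \<Theta> P =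
     {g \<in> borel_measurable (\<Omega> \<Otimes>\<^sub>M \<Theta>). \<forall>\<theta>\<in>space \<Theta>. (\<integral>\<^sup>+\<omega>. g (\<omega>, \<theta>) \<partial>P \<theta>) \<le> 1}"

text \<open>On \<^typ>\<open>ennreal\<close>, multiplication satisfies \<open>0 * \<infinity> = 0\<close>, which is the intended convention.\<close>

definition e_product ::
  "('w \<times> 't) measure \<Rightarrow> ('w \<times> 't \<Rightarrow> ennreal) set \<Rightarrow> ('t \<Rightarrow> ennreal) set \<Rightarrow> ('w \<times> 't \<Rightarrow> ennreal) set" where
  "e_product T G H =
     {f \<in> borel_measurable T. \<exists>g\<in>G. \<exists>h\<in>H. AE (\<omega>, \<theta>) in T. f (\<omega>, \<theta>) = g (\<omega>, \<theta>) * h \<theta>}"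

end

theory Submission
  imports Defs
begin

text \<open>
  The joint measure \<open>T\<close> disintegrates: integrating a non-negative function of \<open>(\<omega>, \<theta>)\<close> against
  \<open>T\<close> amounts to integrating over \<open>\<omega>\<close> against \<open>P \<theta>\<close> and then over \<open>\<theta>\<close> against \<open>Q\<close>
  (\<open>nn_integral_joint_measure\<close>).

  Hence a product \<open>g * h\<close> of a conditional e-function and an e-function has \<open>T\<close>-integral
  \<open>\<integral> h(\<theta>) (\<integral> g(\<omega>, \<theta>) P\<^sub>\<theta>(d\<omega>)) Q(d\<theta>) \<le> \<integral> h dQ \<le> 1\<close>.

  Conversely, given \<open>f\<close> with \<open>\<integral> f dT \<le> 1\<close>, take for \<open>h\<close> the
  conditional expectation \<open>h(\<theta>) = \<integral> f(\<omega>, \<theta>) P\<^sub>\<theta>(d\<omega>)\<close>, whose \<open>Q\<close>-integral is \<open>\<integral> f dT\<close>, and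
  for the other factor the quotient \<open>g = f / h\<close>.  Its conditional expectation is \<open>h(\<theta>) / h(\<theta>)\<close>, which
  is at most 1 for every \<open>\<theta>\<close>, because \<open>0 / 0 = \<infinity> / \<infinity> = 0\<close> for extended non-negative reals.
  The identity \<open>f = g * h\<close> can fail only where \<open>h(\<theta>) = \<infinity>\<close>, which is \<open>Q\<close>-null because \<open>h\<close> is
  integrable, and where \<open>h(\<theta>) = 0\<close> but \<open>f(\<omega>, \<theta>) > 0\<close>, which is \<open>P\<^sub>\<theta>\<close>-null for each such \<open>\<theta>\<close>.
\<close>

lemma statistical_model_kernel:
  assumes "statistical_model \<Omega> \<Theta> P" and "sets Q = sets \<Theta>"
  shows "P \<in> Q \<rightarrow>\<^sub>M subprob_algebra \<Omega>"
proof -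
  have "P \<in> \<Theta> \<rightarrow>\<^sub>M subprob_algebra \<Omega>"
    using assms(1) unfolding statistical_model_iff_prob_kernel by (rule measurable_prob_algebraD)
  then show ?thesis
    using measurable_cong_sets[OF assms(2) refl] by blast
qed

lemma measurable_Pair_kernel:
  assumes "P \<in> Q \<rightarrow>\<^sub>M subprob_algebra \<Omega>" and "\<theta> \<in> space Q"
  shows "(\<lambda>\<omega>. (\<omega>, \<theta>)) \<in> P \<theta> \<rightarrow>\<^sub>M \<Omega> \<Otimes>\<^sub>M Q"
  using measurable_Pair2'[OF assms(2), of \<Omega>]
    measurable_cong_sets[OF sets_kernel[OF assms] refl] by blast

lemma measurable_embedded_kernel:
  assumes P[measurable]: "P \<in> Q \<rightarrow>\<^sub>M subprob_algebra \<Omega>"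
  shows "(\<lambda>\<theta>. distr (P \<theta>) (\<Omega> \<Otimes>\<^sub>M Q) (\<lambda>\<omega>. (\<omega>, \<theta>))) \<in> Q \<rightarrow>\<^sub>M subprob_algebra (\<Omega> \<Otimes>\<^sub>M Q)"
  by (rule measurable_distr2[OF _ P]) simp

text \<open>
  Placing \<open>P \<theta>\<close> on the slice \<open>\<Omega> \<times> {\<theta>}\<close> exhibits \<open>T\<close> as a \<open>Q\<close>-mixture of measures on the product,
  so that the calculus of the Giry monad applies.  Both sides agree on measurable rectangles,
  which are stable under intersection and generate the product.
\<close>

lemma joint_measure_eq_bind:
  assumes P: "P \<in> Q \<rightarrow>\<^sub>M subprob_algebra \<Omega>"
    and Q: "prob_space Q" "sets Q = sets \<Theta>"
    and T: "joint_measure \<Omega> \<Theta> P Q T"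
  shows "T = Q \<bind> (\<lambda>\<theta>. distr (P \<theta>) (\<Omega> \<Otimes>\<^sub>M Q) (\<lambda>\<omega>. (\<omega>, \<theta>)))"
    (is "T = Q \<bind> ?J")
proof (rule measure_eqI_generator_eq[OF Int_stable_pair_measure_generator pair_measure_closed,
      where A = "\<lambda>_::nat. space \<Omega> \<times> space Q"])
  have ne: "space Q \<noteq> {}"
    using Q(1) by (rule prob_space.not_empty)
  have "sets (\<Omega> \<Otimes>\<^sub>M \<Theta>) = sets (\<Omega> \<Otimes>\<^sub>M Q)"
    using Q(2) by (intro sets_pair_measure_cong) auto
  then show "sets T = sigma_sets (space \<Omega> \<times> space Q) {a \<times> b |a b. a \<in> sets \<Omega> \<and> b \<in> sets Q}"
    using T by (simp add: joint_measure_def sets_pair_measure)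
  show "sets (Q \<bind> ?J) = sigma_sets (space \<Omega> \<times> space Q) {a \<times> b |a b. a \<in> sets \<Omega> \<and> b \<in> sets Q}"
    using ne by (subst sets_bind[of _ _ "\<Omega> \<Otimes>\<^sub>M Q"]) (simp_all add: sets_pair_measure)
  have "finite_measure T"
    using T by (auto simp: joint_measure_def prob_space_def)
  then show "emeasure T (space \<Omega> \<times> space Q) \<noteq> \<infinity>" for i :: nat
    by (simp add: finite_measure.emeasure_finite)
  fix X assume "X \<in> {a \<times> b |a b. a \<in> sets \<Omega> \<and> b \<in> sets Q}"
  then obtain A B where X: "X = A \<times> B" and A: "A \<in> sets \<Omega>" and B: "B \<in> sets Q"
    by blast
  have AB: "A \<times> B \<in> sets (\<Omega> \<Otimes>\<^sub>M Q)"
    using A B by simp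
  have "emeasure (Q \<bind> ?J) (A \<times> B) = (\<integral>\<^sup>+\<theta>. emeasure (?J \<theta>) (A \<times> B) \<partial>Q)"
    by (rule emeasure_bind[OF ne measurable_embedded_kernel[OF P] AB])
  also have "\<dots> = (\<integral>\<^sup>+\<theta>\<in>B. emeasure (P \<theta>) A \<partial>Q)"
  proof (rule nn_integral_cong)
    fix \<theta> assume \<theta>: "\<theta> \<in> space Q"
    have "(\<lambda>\<omega>. (\<omega>, \<theta>)) -` (A \<times> B) \<inter> space (P \<theta>) = (if \<theta> \<in> B then A else {})"
      using sets.sets_into_space[OF A] subprob_measurableD(1)[OF P \<theta>] by auto
    then show "emeasure (?J \<theta>) (A \<times> B) = emeasure (P \<theta>) A * indicator B \<theta>"
      by (simp add: emeasure_distr[OF measurable_Pair_kernel[OF P \<theta>] AB])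
  qed
  also have "\<dots> = emeasure T (A \<times> B)"
    using T A B Q(2) by (simp add: joint_measure_def)
  finally show "emeasure T X = emeasure (Q \<bind> ?J) X"
    by (simp add: X)
qed auto

lemma nn_integral_joint_measure:
  assumes P: "P \<in> Q \<rightarrow>\<^sub>M subprob_algebra \<Omega>"
    and Q: "prob_space Q" "sets Q = sets \<Theta>"
    and T: "joint_measure \<Omega> \<Theta> P Q T"
    and f: "f \<in> borel_measurable (\<Omega> \<Otimes>\<^sub>M Q)"
  shows "(\<integral>\<^sup>+x. f x \<partial>T) = (\<integral>\<^sup>+\<theta>. \<integral>\<^sup>+\<omega>. f (\<omega>, \<theta>) \<partial>P \<theta> \<partial>Q)"
  unfolding joint_measure_eq_bind[OF P Q T]
    nn_integral_bind[OF f measurable_embedded_kernel[OF P]]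
  by (intro nn_integral_cong nn_integral_distr measurable_Pair_kernel[OF P])
    (simp_all add: f)

lemma AE_joint_measure_iff:
  assumes P: "P \<in> Q \<rightarrow>\<^sub>M subprob_algebra \<Omega>"
    and Q: "prob_space Q" "sets Q = sets \<Theta>"
    and T: "joint_measure \<Omega> \<Theta> P Q T"
    and p[measurable]: "Measurable.pred (\<Omega> \<Otimes>\<^sub>M Q) p"
  shows "(AE x in T. p x) \<longleftrightarrow> (AE \<theta> in Q. AE \<omega> in P \<theta>. p (\<omega>, \<theta>))"
  unfolding joint_measure_eq_bind[OF P Q T] AE_bind[OF measurable_embedded_kernel[OF P] p]
  by (intro AE_cong AE_distr_iff measurable_Pair_kernel[OF P]) simp_all

lemma measurable_conditional_nn_integral:
  assumes P: "P \<in> Q \<rightarrow>\<^sub>M subprob_algebra \<Omega>"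
    and f[measurable]: "f \<in> borel_measurable (\<Omega> \<Otimes>\<^sub>M Q)"
  shows "(\<lambda>\<theta>. \<integral>\<^sup>+\<omega>. f (\<omega>, \<theta>) \<partial>P \<theta>) \<in> borel_measurable Q"
  by (rule nn_integral_measurable_subprob_algebra2[OF _ P]) measurable

theorem proposition7:
  fixes \<Omega> :: "'w measure" and \<Theta> :: "'t measure"
    and P :: "'t \<Rightarrow> 'w measure" and Q :: "'t measure" and T :: "('w \<times> 't) measure"
  assumes "statistical_model \<Omega> \<Theta> P"
    and "prob_space Q" and "sets Q = sets \<Theta>"
    and "joint_measure \<Omega> \<Theta> P Q T"
  shows "e_functions T = e_product T (conditional_e_functions \<Omega> \<Theta> P) (e_functions Q)"
proof -
  note P = statistical_model_kernel[OF assms(1,3)]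
  note Q = assms(2,3) and T = assms(4)
  note integral_T = nn_integral_joint_measure[OF P Q T]
  have sets_pair: "sets (\<Omega> \<Otimes>\<^sub>M Q) = sets (\<Omega> \<Otimes>\<^sub>M \<Theta>)"
    using Q(2) by (intro sets_pair_measure_cong) auto
  then have meas_T: "borel_measurable T = borel_measurable (\<Omega> \<Otimes>\<^sub>M Q)"
    using T by (intro measurable_cong_sets) (auto simp: joint_measure_def)
  have meas_G: "borel_measurable (\<Omega> \<Otimes>\<^sub>M \<Theta>) = borel_measurable (\<Omega> \<Otimes>\<^sub>M Q)"
    using sets_pair by (intro measurable_cong_sets) auto
  have space_Q: "space Q = space \<Theta>"
    using Q(2) by (rule sets_eq_imp_space_eq)
  have slice: "(\<lambda>\<omega>. f (\<omega>, \<theta>)) \<in> borel_measurable (P \<theta>)"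
    if "f \<in> borel_measurable (\<Omega> \<Otimes>\<^sub>M Q)" "\<theta> \<in> space Q" for f :: "'w \<times> 't \<Rightarrow> ennreal" and \<theta>
    using measurable_compose[OF measurable_Pair_kernel[OF P that(2)] that(1)] .
  show ?thesis
  proof (intro equalityI subsetI)
    fix f assume "f \<in> e_functions T"
    then have f[measurable]: "f \<in> borel_measurable (\<Omega> \<Otimes>\<^sub>M Q)" and f_le: "(\<integral>\<^sup>+x. f x \<partial>T) \<le> 1"
      by (auto simp: e_functions_def meas_T)
    define h where "h = (\<lambda>\<theta>. \<integral>\<^sup>+\<omega>. f (\<omega>, \<theta>) \<partial>P \<theta>)"
    define g where "g = (\<lambda>(\<omega>, \<theta>). f (\<omega>, \<theta>) / h \<theta>)"
    have h[measurable]: "h \<in> borel_measurable Q"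
      unfolding h_def by (rule measurable_conditional_nn_integral[OF P f])
    have g[measurable]: "g \<in> borel_measurable (\<Omega> \<Otimes>\<^sub>M Q)"
      unfolding g_def by measurable
    have h_le: "(\<integral>\<^sup>+\<theta>. h \<theta> \<partial>Q) \<le> 1"
      using f_le unfolding h_def integral_T[OF f] .
    have "(\<integral>\<^sup>+\<omega>. g (\<omega>, \<theta>) \<partial>P \<theta>) \<le> 1" if \<theta>: "\<theta> \<in> space Q" for \<theta>
    proof -
      have "(\<integral>\<^sup>+\<omega>. g (\<omega>, \<theta>) \<partial>P \<theta>) = h \<theta> / h \<theta>"
        unfolding g_def by (simp add: nn_integral_divide slice[OF f \<theta>] h_def)
      also have "\<dots> \<le> 1"
        by (cases "h \<theta> = 0 \<or> h \<theta> = top") (auto simp: less_top)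
      finally show ?thesis .
    qed
    then have G: "g \<in> conditional_e_functions \<Omega> \<Theta> P"
      using g by (simp add: conditional_e_functions_def meas_G space_Q)
    have H: "h \<in> e_functions Q"
      using h h_le by (simp add: e_functions_def)
    have "AE \<theta> in Q. h \<theta> \<noteq> \<infinity>"
      using h_le by (intro nn_integral_PInf_AE) (auto simp: top_unique)
    then have "AE \<theta> in Q. AE \<omega> in P \<theta>. f (\<omega>, \<theta>) = g (\<omega>, \<theta>) * h \<theta>"
      using AE_space
    proof eventually_elim
      case (elim \<theta>)
      show ?case
      proof (cases "h \<theta> = 0")
        case True
        then have "AE \<omega> in P \<theta>. f (\<omega>, \<theta>) = 0"
          using nn_integral_0_iff_AE[OF slice[OF f elim(2)]] by (simp add: h_def)
        then show ?thesis
          by (simp add: True)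
      next
        case False
        with elim(1) show ?thesis
          by (simp add: g_def ennreal_divide_times less_top)
      qed
    qed
    then have "AE x in T. f x = g x * h (snd x)"
      by (subst AE_joint_measure_iff[OF P Q T]) simp_all
    then show "f \<in> e_product T (conditional_e_functions \<Omega> \<Theta> P) (e_functions Q)"
      using f G H by (auto simp: e_product_def meas_T case_prod_beta)
  next
    fix f assume "f \<in> e_product T (conditional_e_functions \<Omega> \<Theta> P) (e_functions Q)"
    then obtain g h where f: "f \<in> borel_measurable T"
      and g[measurable]: "g \<in> borel_measurable (\<Omega> \<Otimes>\<^sub>M Q)"
      and g_le: "\<And>\<theta>. \<theta> \<in> space Q \<Longrightarrow> (\<integral>\<^sup>+\<omega>. g (\<omega>, \<theta>) \<partial>P \<theta>) \<le> 1"
      and h[measurable]: "h \<in> borel_measurable Q" and h_le: "(\<integral>\<^sup>+\<theta>. h \<theta> \<partial>Q) \<le> 1"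
      and eq: "AE x in T. f x = g x * h (snd x)"
      by (auto simp: e_product_def conditional_e_functions_def e_functions_def meas_G space_Q
          case_prod_beta)
    have "(\<integral>\<^sup>+x. f x \<partial>T) = (\<integral>\<^sup>+x. g x * h (snd x) \<partial>T)"
      by (rule nn_integral_cong_AE[OF eq])
    also have "\<dots> = (\<integral>\<^sup>+\<theta>. \<integral>\<^sup>+\<omega>. g (\<omega>, \<theta>) * h \<theta> \<partial>P \<theta> \<partial>Q)"
      by (subst integral_T) simp_all
    also have "\<dots> = (\<integral>\<^sup>+\<theta>. (\<integral>\<^sup>+\<omega>. g (\<omega>, \<theta>) \<partial>P \<theta>) * h \<theta> \<partial>Q)"
      by (intro nn_integral_cong nn_integral_multc slice[OF g])
    also have "\<dots> \<le> (\<integral>\<^sup>+\<theta>. 1 * h \<theta> \<partial>Q)"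
      by (intro nn_integral_mono mult_right_mono g_le) simp_all
    also have "\<dots> \<le> 1"
      using h_le by simp
    finally show "f \<in> e_functions T"
      using f by (simp add: e_functions_def)
  qed
qed

end
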